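(* The explicit formulas for the Mersenne Lucas polynomials $m_n(x)$ and the Gaussian Mersenne Lucas polynomials $Gm_n(x)$ are respectively given by $$m_n(x)=\sum_{j=0}^{\lfloor n/2\rfloor}(-1)^j\frac{n}{n-j}\binom{n-j}{j}(3x)^{n-2j}2^j,$$ $$Gm_n(x)=\sum_{j=0}^{\lfloor n/2\rfloor}(-1)^j\frac{n}{n-j}\binom{n-j}{j}(3x)^{n-2j}2^j+i\sum_{j=0}^{\lfloor (n-1)/2\rfloor}(-1)^j\frac{n-1}{n-j-1}\binom{n-j-1}{j}(3x)^{n-2j-1}2^j.$$
   Context: Here $i$ is the imaginary unit and $x$ is the polynomial variable. The Mersenne Lucas polynomials $\{m_n(x)\}_{n\ge0}$ are defined by $m_0(x)=2$, $m_1(x)=3x$, and $m_n(x)=3x\,m_{n-1}(x)-2m_{n-2}(x)$ for $n\ge2$. The Gaussian Mersenne Lucas polynomials $\{Gm_n(x)\}_{n\ge0}$ are defined by $Gm_0(x)=2+\frac{3i}{2}x$, $Gm_1(x)=3x+2i$, and $Gm_n(x)=3x\,Gm_{n-1}(x)-2Gm_{n-2}(x)$ for $n\ge2$.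
   Formalization: The formula for m_n(x) is stated for n ≥ 1 and that for Gm_n(x) for n ≥ 2; at n = 0 (and at n = 1 for Gm_n) the sums contain the undefined factor 0/0, and for Gm_0 no value of it gives the term (3i/2)x. *)

theory Defs
  imports Complex_Main "HOL-Computational_Algebra.Polynomial"
begin

abbreviation polyvar :: "complex poly" where
  "polyvar \<equiv> [:0, 1:]"

fun mersenne_lucas :: "nat \<Rightarrow> complex poly" where
  "mersenne_lucas 0 = 2"
| "mersenne_lucas (Suc 0) = 3 * polyvar"
| "mersenne_lucas (Suc (Suc n)) =
     3 * polyvar * mersenne_lucas (Suc n) - 2 * mersenne_lucas n"

fun gauss_mersenne_lucas :: "nat \<Rightarrow> complex poly" where
  "gauss_mersenne_lucas 0 = 2 + smult (3 * \<i> / 2) polyvar"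
| "gauss_mersenne_lucas (Suc 0) = 3 * polyvar + [:2 * \<i>:]"
| "gauss_mersenne_lucas (Suc (Suc n)) =
     3 * polyvar * gauss_mersenne_lucas (Suc n) - 2 * gauss_mersenne_lucas n"

end

theory Submission
  imports Defs
begin

text \<open>
  Both sequences are Lucas-type sequences: they obey the recurrence $u_{n+2} = X u_{n+1} + y u_n$
  with $X = 3x$ and $y = -2$. The solution starting with $1, X$ is the bivariate Fibonacci
  polynomial $F_n = \sum_j \binom{n-j}{j} X^{n-2j} y^j$ (the sum over the tilings of a strip of
  length $n$ by squares of weight $X$ and dominoes of weight $y$), whose recurrence is Pascal's
  rule applied to the coefficients (\<open>fib_poly_rec\<close>).

  The solution starting with $2, X$ is $F_n + y F_{n-2}$ for $n \ge 2$ (tilings of a circle: the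
  second summand counts those in which a domino covers the seam). Collecting the coefficient
  of $X^{n-2j} y^j$ gives $\binom{n-j}{j} + \binom{n-j-1}{j-1}$, and by the absorption identity
  for binomial coefficients this is $\frac{n}{n-j}\binom{n-j}{j}$ (\<open>lucas_coeff_eq\<close>).
  This proves the formula for $m_n$.

  For the Gaussian polynomials, linearity of the recurrence gives $Gm_n = m_n + i\,m_{n-1}$ for
  $n \ge 1$. Running the Lucas recurrence backwards yields $m_{-1} = \frac{3}{2}x$, so the
  prescribed initial value $Gm_0$ fits the same pattern.
\<close>

section \<open>Bivariate Fibonacci polynomials\<close>

definition fib_poly :: "'a::comm_ring_1 \<Rightarrow> 'a \<Rightarrow> nat \<Rightarrow> 'a" where
  "fib_poly X y n = (\<Sum>j=0..n div 2. of_nat ((n - j) choose j) * X ^ (n - 2 * j) * y ^ j)"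

text \<open>
  The binomial coefficient vanishes beyond \<open>n div 2\<close>, even where the subtraction \<open>n - j\<close>
  is truncated, so sums for different \<open>n\<close> can be brought to a common range.
\<close>

lemma fib_poly_extend:
  assumes "n div 2 \<le> N"
  shows "fib_poly X y n = (\<Sum>j\<le>N. of_nat ((n - j) choose j) * X ^ (n - 2 * j) * y ^ j)"
  unfolding fib_poly_def
proof (rule sum.mono_neutral_left)
  show "\<forall>j\<in>{..N} - {0..n div 2}. of_nat ((n - j) choose j) * X ^ (n - 2 * j) * y ^ j = 0"
  proof
    fix j assume "j \<in> {..N} - {0..n div 2}"
    then have "n - j < j" by auto
    then show "of_nat ((n - j) choose j) * X ^ (n - 2 * j) * y ^ j = 0"
      by (simp add: binomial_eq_0)
  qed
qed (use assms in auto)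

lemma fib_poly_rec:
  "fib_poly X y (Suc (Suc n)) = X * fib_poly X y (Suc n) + y * fib_poly X y n"
proof -
  define P where "P k = of_nat ((n - k) choose Suc k) * X ^ (n - 2 * k) * y ^ Suc k" for k
  have pascal: "of_nat ((Suc n - k) choose Suc k) * X ^ (n - 2 * k) * (y * y ^ k)
      = P k + y * (of_nat ((n - k) choose k) * X ^ (n - 2 * k) * y ^ k)" if "k \<le> n" for k
    using that by (simp add: P_def Suc_diff_le algebra_simps)
  have shift: "X * (of_nat ((n - k) choose Suc k) * X ^ (n - Suc (2 * k)) * (y * y ^ k)) = P k" for k
  proof (cases "2 * k < n")
    case True
    then have "X ^ (n - 2 * k) = X * X ^ (n - Suc (2 * k))"
      by (simp only: power_Suc[symmetric] Suc_diff_Suc)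
    then show ?thesis unfolding P_def by (simp only: power_Suc ac_simps)
  next
    \<comment> \<open>Here the exponent on the left is truncated, but the coefficient is zero.\<close>
    case False
    then have "n - k < Suc k" by simp
    then show ?thesis by (simp add: P_def binomial_eq_0)
  qed
  have "fib_poly X y (Suc (Suc n))
      = X ^ Suc (Suc n) + (\<Sum>k\<le>n. P k)
        + y * (\<Sum>k\<le>n. of_nat ((n - k) choose k) * X ^ (n - 2 * k) * y ^ k)"
    by (subst fib_poly_extend[of _ "Suc n"], simp, subst sum.atMost_Suc_shift)
       (simp add: pascal sum.distrib sum_distrib_left cong: sum.cong_simp)
  moreover have "X * fib_poly X y (Suc n) = X ^ Suc (Suc n) + (\<Sum>k\<le>n. P k)"
    by (subst fib_poly_extend[of _ "Suc n"], simp, subst sum.atMost_Suc_shift)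
       (simp add: shift distrib_left sum_distrib_left)
  moreover have "fib_poly X y n
      = (\<Sum>k\<le>n. of_nat ((n - k) choose k) * X ^ (n - 2 * k) * y ^ k)"
    by (rule fib_poly_extend) simp
  ultimately show ?thesis by simp
qed

section \<open>Explicit formula for Lucas-type sequences\<close>

lemma lucas_eq_fib_poly:
  fixes u :: "nat \<Rightarrow> 'a::comm_ring_1"
  assumes "u 0 = 2" "u (Suc 0) = X" and rec: "\<And>n. u (Suc (Suc n)) = X * u (Suc n) + y * u n"
  shows "u (Suc (Suc n)) = fib_poly X y (Suc (Suc n)) + y * fib_poly X y n"
proof -
  have F01: "fib_poly X y 0 = 1" "fib_poly X y (Suc 0) = X"
    by (simp_all add: fib_poly_def)
  show ?thesis
  proof (induction n rule: induct_nat_012)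
    case (ge2 n)
    show ?case
      by (simp only: rec[of "Suc (Suc n)"] ge2.IH fib_poly_rec[of X y n]
            fib_poly_rec[of X y "Suc (Suc n)"])
         (simp add: algebra_simps)
  qed (simp_all add: rec fib_poly_rec assms(1,2) F01 algebra_simps)
qed

definition lucas_coeff :: "nat \<Rightarrow> nat \<Rightarrow> nat" where
  "lucas_coeff n j = ((n - j) choose j) + (if j = 0 then 0 else (n - 1 - j) choose (j - 1))"

text \<open>
  For $j > 0$, absorption turns $(n-j)\binom{n-j-1}{j-1}$ into $j\binom{n-j}{j}$, so that
  multiplying the left-hand side by $n-j$ gives $((n-j)+j)\binom{n-j}{j}$.
\<close>

lemma lucas_coeff_eq:
  assumes "j < n"
  shows "(of_nat (lucas_coeff n j) :: 'a::field_char_0)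
    = of_nat n / of_nat (n - j) * of_nat ((n - j) choose j)"
proof -
  have "(n - j) * lucas_coeff n j = n * ((n - j) choose j)"
  proof (cases j)
    case 0
    then show ?thesis by (simp add: lucas_coeff_def)
  next
    case (Suc k)
    obtain r where r: "n = Suc r + j"
      using assms by (metis add.commute less_imp_Suc_add add_Suc_right)
    have "Suc r * (r choose k) = (Suc r choose Suc k) * Suc k"
      by (rule Suc_times_binomial_eq)
    then show ?thesis
      using r Suc by (simp add: lucas_coeff_def algebra_simps)
  qed
  then have "(of_nat (n - j) * of_nat (lucas_coeff n j) :: 'a)
      = of_nat n * of_nat ((n - j) choose j)"
    by (metis of_nat_mult)
  moreover have "(of_nat (n - j) :: 'a) \<noteq> 0"
    using assms by simp
  ultimately show ?thesis
    by (simp add: field_simps)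
qed

text \<open>
  The range \<open>n \<ge> 1\<close> is sharp: for \<open>n = 0\<close> the only coefficient is \<open>1\<close>, while the sequence
  starts with \<open>2\<close>.
\<close>

lemma lucas_explicit:
  fixes u :: "nat \<Rightarrow> 'a::comm_ring_1"
  assumes "u 0 = 2" "u (Suc 0) = X" and "\<And>n. u (Suc (Suc n)) = X * u (Suc n) + y * u n"
    and "n \<ge> 1"
  shows "u n = (\<Sum>j=0..n div 2. of_nat (lucas_coeff n j) * X ^ (n - 2 * j) * y ^ j)"
proof (cases "n = 1")
  case True
  then show ?thesis by (simp add: assms(2) lucas_coeff_def)
next
  case False
  with \<open>n \<ge> 1\<close> obtain m where n: "n = Suc (Suc m)"
    by (metis One_nat_def not_one_le_zero old.nat.exhaust)
  have "y * fib_poly X y m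
      = (\<Sum>k=0..m div 2. of_nat ((m - k) choose k) * X ^ (m - 2 * k) * y ^ Suc k)"
    by (simp add: fib_poly_def sum_distrib_left ac_simps)
  \<comment> \<open>Shift the index so that both sums range over the same powers of \<open>y\<close>.\<close>
  also have "\<dots> = (\<Sum>j=0..n div 2. of_nat (if j = 0 then 0 else (n - 1 - j) choose (j - 1))
        * X ^ (n - 2 * j) * y ^ j)"
    unfolding n by (simp add: sum.atLeast0_atMost_Suc_shift del: sum.cl_ivl_Suc)
  finally show ?thesis
    using lucas_eq_fib_poly[of u X y m, OF assms(1-3)]
    by (simp add: n[symmetric] fib_poly_def lucas_coeff_def sum.distrib[symmetric] algebra_simps)
qed

section \<open>Mersenne Lucas polynomials\<close>

lemma mersenne_lucas_explicit:
  assumes "n \<ge> 1"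
  shows "mersenne_lucas n =
    (\<Sum>j=0..n div 2.
      (-1) ^ j * smult (of_nat n / of_nat (n - j) * of_nat ((n - j) choose j))
        ((3 * polyvar) ^ (n - 2 * j) * 2 ^ j))"
proof -
  have "mersenne_lucas n =
      (\<Sum>j=0..n div 2. of_nat (lucas_coeff n j) * (3 * polyvar) ^ (n - 2 * j) * (- 2) ^ j)"
    by (rule lucas_explicit) (use assms in simp_all)
  also have "\<dots> = (\<Sum>j=0..n div 2.
      (-1) ^ j * smult (of_nat n / of_nat (n - j) * of_nat ((n - j) choose j))
        ((3 * polyvar) ^ (n - 2 * j) * 2 ^ j))"
  proof (rule sum.cong[OF refl])
    fix j assume "j \<in> {0..n div 2}"
    with assms have "j < n" by auto
    have "(of_nat (lucas_coeff n j) :: complex poly) * (3 * polyvar) ^ (n - 2 * j) * (- 2) ^ j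
        = (-1) ^ j * (of_nat (lucas_coeff n j) * ((3 * polyvar) ^ (n - 2 * j) * 2 ^ j))"
      by (subst power_minus) (simp only: ac_simps)
    also have "\<dots> = (-1) ^ j * smult (of_nat (lucas_coeff n j))
        ((3 * polyvar) ^ (n - 2 * j) * 2 ^ j)"
      by (simp only: of_nat_poly mult_pCons_left mult_zero_left pCons_0_0 add_0_right)
    finally show "of_nat (lucas_coeff n j) * (3 * polyvar) ^ (n - 2 * j) * (- 2) ^ j
        = (-1) ^ j * smult (of_nat n / of_nat (n - j) * of_nat ((n - j) choose j))
            ((3 * polyvar) ^ (n - 2 * j) * 2 ^ j)"
      by (simp only: lucas_coeff_eq[OF \<open>j < n\<close>])
  qed
  finally show ?thesis .
qed

lemma gauss_mersenne_lucas_eq: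
  "gauss_mersenne_lucas (Suc n) = mersenne_lucas (Suc n) + smult \<i> (mersenne_lucas n)"
proof (induction n rule: induct_nat_012)
  case 0
  show ?case by (simp add: numeral_poly)
next
  case 1
  show ?case by (simp add: numeral_poly algebra_simps)
next
  case (ge2 n)
  have linear: "a * (p + smult \<i> q) - 2 * (q + smult \<i> r)
      = (a * p - 2 * q) + smult \<i> (a * q - 2 * r)" for a p q r :: "complex poly"
    by (simp add: algebra_simps smult_diff_right smult_add_right)
  show ?case
    by (simp only: gauss_mersenne_lucas.simps(3)[of "Suc n"] ge2.IH linear
          mersenne_lucas.simps(3)[symmetric])
qed

theorem theorem11:
  shows "(\<forall>n::nat. n \<ge> 1 \<longrightarrow>
      mersenne_lucas n =
        (\<Sum>j=0..n div 2.
          (-1) ^ j * smult (of_nat n / of_nat (n - j) * of_nat ((n - j) choose j))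
            ((3 * polyvar) ^ (n - 2 * j) * 2 ^ j))) \<and>
    (\<forall>n::nat. n \<ge> 2 \<longrightarrow>
      gauss_mersenne_lucas n =
        (\<Sum>j=0..n div 2.
          (-1) ^ j * smult (of_nat n / of_nat (n - j) * of_nat ((n - j) choose j))
            ((3 * polyvar) ^ (n - 2 * j) * 2 ^ j))
        + smult \<i> (\<Sum>j=0..(n - 1) div 2.
          (-1) ^ j * smult (of_nat (n - 1) / of_nat (n - j - 1) * of_nat ((n - j - 1) choose j))
            ((3 * polyvar) ^ (n - 2 * j - 1) * 2 ^ j)))"
proof (intro conjI allI impI)
  fix n :: nat assume "n \<ge> 2"
  then have "gauss_mersenne_lucas n = mersenne_lucas n + smult \<i> (mersenne_lucas (n - 1))"
    using gauss_mersenne_lucas_eq[of "n - 1"] by simp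
  moreover have "n - 1 - j = n - j - 1" "n - 1 - 2 * j = n - 2 * j - 1" for j
    by simp_all
  ultimately show "gauss_mersenne_lucas n =
        (\<Sum>j=0..n div 2.
          (-1) ^ j * smult (of_nat n / of_nat (n - j) * of_nat ((n - j) choose j))
            ((3 * polyvar) ^ (n - 2 * j) * 2 ^ j))
        + smult \<i> (\<Sum>j=0..(n - 1) div 2.
          (-1) ^ j * smult (of_nat (n - 1) / of_nat (n - j - 1) * of_nat ((n - j - 1) choose j))
            ((3 * polyvar) ^ (n - 2 * j - 1) * 2 ^ j))"
    using mersenne_lucas_explicit[of n] mersenne_lucas_explicit[of "n - 1"] \<open>n \<ge> 2\<close>
    by (simp only:)
qed (rule mersenne_lucas_explicit)

end
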